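(* Let $V_1, V_2$ be positive integers with $\gcd(V_1,V_2)=1$ and let $(V_m)_{m\ge 1}$ satisfy $V_m=V_{m-1}+V_{m-2}$ for $m\ge 3$. Let $n$ be a positive integer. If $S=\langle V_n,V_{n+2},V_{n+4},\ldots\rangle$, then: (i) $\mathbf{F}(S)=s(V_n-1)-V_n$; (ii) \[ \mathbf{g}(S)=\frac{1}{V_n}\left(\sum_{x=1}^{V_n-1}s(x)\right)-\frac{V_n-1}{2}. \]
   Context: For a set $A$ of positive integers, $\langle A\rangle$ denotes the set of all finite linear combinations of elements of $A$ with non-negative integer coefficients. The Frobenius number $\mathbf{F}(S)$ is the largest element of $\mathbb{Z}_{\ge 0}\setminus S$ and the genus $\mathbf{g}(S)$ is the cardinality of $\mathbb{Z}_{\ge 0}\setminus S$. $F_m$ denotes the Fibonacci sequence: $F_0=0$, $F_1=F_2=1$, $F_m=F_{m-1}+F_{m-2}$. Definition of $s(x)$ (depending on the sequence $(V_m)$ and on $n$): for a positive integer $x$, let $k\ge1$ be such that $F_{2k}\le x<F_{2k+2}$, and define $\lambda_k,\lambda_{k-1},\ldots,\lambda_1$ by the greedy algorithm with respect to $F_2,F_4,\ldots,F_{2k}$: $\lambda_k=\lfloor x/F_{2k}\rfloor$ and $\lambda_j=\left\lfloor \left(x-\sum_{i=j+1}^k\lambda_iF_{2i}\right)/F_{2j}\right\rfloor$ for $j=k-1,\ldots,1$; then $x=\sum_{i=1}^k\lambda_iF_{2i}$, and one sets $s(x)=\sum_{i=1}^k\lambda_iV_{n+2i}$. *)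

theory Defs
  imports Complex_Main "HOL-Number_Theory.Fib"
begin

definition nonneg_combinations :: "nat set \<Rightarrow> nat set" where
  "nonneg_combinations A = {\<Sum>a\<in>T. c a * a | (T :: nat set) (c :: nat \<Rightarrow> nat). finite T \<and> T \<subseteq> A}"

definition gaps :: "nat set \<Rightarrow> nat set" where
  "gaps S = UNIV - S"

text \<open>
  The value -1 in the absence of gaps is the usual convention for the Frobenius number of the
  semigroup of all non-negative integers, where there is no largest gap.
  Both \<open>frobenius_number\<close> and \<open>genus\<close> are meaningful only if \<open>gaps S\<close> is finite.
\<close>
definition frobenius_number :: "nat set \<Rightarrow> int" where
  "frobenius_number S = (if gaps S = {} then -1 else int (Max (gaps S)))"

definition genus :: "nat set \<Rightarrow> nat" where
  "genus S = card (gaps S)"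

text \<open>For \<open>x > 0\<close> there is exactly one such \<open>k\<close>; for \<open>x = 0\<close> there is none.\<close>
definition fib_index :: "nat \<Rightarrow> nat" where
  "fib_index x = (THE k. k \<ge> 1 \<and> fib (2 * k) \<le> x \<and> x < fib (2 * k + 2))"

text \<open>
  \<open>greedy_coeff k x j\<close> is the coefficient of \<open>fib (2 * j)\<close>, for \<open>1 \<le> j \<le> k\<close>, in the greedy
  expansion of \<open>x\<close> that starts with \<open>fib (2 * k)\<close>. The subtraction on the naturals never
  truncates, because what the earlier coefficients account for is at most \<open>x\<close>.
\<close>
function greedy_coeff :: "nat \<Rightarrow> nat \<Rightarrow> nat \<Rightarrow> nat" where
  "greedy_coeff k x j = (x - (\<Sum>i = Suc j..k. greedy_coeff k x i * fib (2 * i))) div fib (2 * j)"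
  by pat_completeness auto
termination
  by (relation "Wellfounded.measure (\<lambda>(k, x, j). k - j)") auto

declare greedy_coeff.simps [simp del]

text \<open>
  \<open>s_value V n 0 = 0\<close>, the value of the empty expansion: all coefficients of 0 vanish, so the
  unspecified \<open>fib_index 0\<close> does not matter.
\<close>
definition s_value :: "(nat \<Rightarrow> nat) \<Rightarrow> nat \<Rightarrow> nat \<Rightarrow> nat" where
  "s_value V n x = (\<Sum>i = 1..fib_index x. greedy_coeff (fib_index x) x i * V (n + 2 * i))"

end

theory Submission
  imports Defs "HOL-Number_Theory.Cong"
begin

text \<open>
  Write \<open>a = V n\<close> and \<open>b = V (n + 1)\<close>, so that \<open>V (n + 2 * i) = fib (2 * i - 1) * a + fib (2 * i) * b\<close>.
  With \<open>\<psi> = (sqrt 5 - 1) / 2\<close> one has \<open>fib (2 * i - 1) - \<psi> * fib (2 * i) = \<psi> ^ (2 * i) > 0\<close>; hence every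
  element of the semigroup is \<open>a * c + b * X\<close> with \<open>c \<ge> \<psi> * X\<close>. The greedy expansion of \<open>x\<close> has
  accumulated error less than 1, so it attains the least integer \<open>c \<ge> \<psi> * x\<close>, which is monotone
  in \<open>x\<close>. Therefore \<open>s x\<close>, for \<open>x < a\<close>, is the least element of the semigroup congruent to \<open>b * x\<close>
  modulo \<open>a\<close>, and both formulas follow from this description of the Apery set.
\<close>

section \<open>Apery sets\<close>

text \<open>Each \<open>w x\<close> is the least element of \<open>S\<close> in its residue class,
  and adding \<open>a\<close> stays in \<open>S\<close>. So the gaps in that class are the
  \<open>w x div a\<close> numbers found by stepping up from the residue in steps of
  \<open>a\<close>.\<close>

lemma gaps_eq_apery:
  fixes a :: nat and w :: "nat \<Rightarrow> nat"
  assumes a: "a > 0"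
    and bij: "bij_betw (\<lambda>x. w x mod a) {..<a} {..<a}"
    and up: "\<And>x j. x < a \<Longrightarrow> w x + a * j \<in> S"
    and low: "\<And>x y. x < a \<Longrightarrow> y \<in> S \<Longrightarrow> y mod a = w x mod a \<Longrightarrow> w x \<le> y"
  shows "gaps S = (\<lambda>(x, j). w x mod a + a * j) ` (SIGMA x:{..<a}. {..<w x div a})"
proof (intro equalityI subsetI)
  fix y assume y: "y \<in> gaps S"
  have "y mod a \<in> (\<lambda>x. w x mod a) ` {..<a}"
    using bij a by (simp add: bij_betw_def)
  then obtain x where x: "x < a" "y mod a = w x mod a" by auto
  have "y < w x"
  proof (rule ccontr)
    assume "\<not> y < w x"
    then have "w x \<le> y" by simp
    then have "a dvd y - w x"
      using x(2) by (simp add: mod_eq_dvd_iff_nat)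
    then obtain q where "y = w x + a * q"
      using \<open>w x \<le> y\<close> by (metis dvdE le_add_diff_inverse)
    with up[OF x(1)] y show False by (simp add: gaps_def)
  qed
  then have "a * (y div a) < a * (w x div a)"
    using x(2) mult_div_mod_eq[of a y] mult_div_mod_eq[of a "w x"] by linarith
  then have "y div a < w x div a" by simp
  moreover have "y = w x mod a + a * (y div a)"
    using x(2) by (metis mod_mult_div_eq)
  ultimately show "y \<in> (\<lambda>(x, j). w x mod a + a * j) ` (SIGMA x:{..<a}. {..<w x div a})"
    using x(1) by (auto intro!: image_eqI[where x = "(x, y div a)"])
next
  fix y assume "y \<in> (\<lambda>(x, j). w x mod a + a * j) ` (SIGMA x:{..<a}. {..<w x div a})"
  then obtain x j where x: "x < a" and j: "j < w x div a" and y: "y = w x mod a + a * j"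
    by auto
  have "y < w x mod a + a * (w x div a)"
    unfolding y using j a by (intro add_strict_left_mono mult_strict_left_mono)
  then have "y < w x" by (simp only: mod_mult_div_eq)
  then show "y \<in> gaps S"
    using low[OF x, of y] y by (auto simp: gaps_def)
qed

text \<open>Counting gaps class by class gives the sum of the quotients \<open>w x div a\<close>.
  The matching remainders permute 0, ..., a - 1, so they sum to a(a - 1)/2.\<close>

lemma genus_apery:
  fixes a :: nat and w :: "nat \<Rightarrow> nat"
  assumes a: "a > 0"
    and bij: "bij_betw (\<lambda>x. w x mod a) {..<a} {..<a}"
    and up: "\<And>x j. x < a \<Longrightarrow> w x + a * j \<in> S"
    and low: "\<And>x y. x < a \<Longrightarrow> y \<in> S \<Longrightarrow> y mod a = w x mod a \<Longrightarrow> w x \<le> y"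
  shows "real (genus S) = 1 / real a * (\<Sum>x<a. real (w x)) - (real a - 1) / 2"
proof -
  let ?f = "\<lambda>(x, j). w x mod a + a * j"
  let ?D = "SIGMA x:{..<a}. {..<w x div a}"
  have "inj_on ?f ?D"
  proof (rule inj_onI)
    fix u u' assume u: "u \<in> ?D" "u' \<in> ?D" "?f u = ?f u'"
    obtain x j x' j' where uu: "u = (x, j)" "u' = (x', j')" by fastforce
    then have x: "x \<in> {..<a}" "x' \<in> {..<a}"
      and eq: "w x mod a + a * j = w x' mod a + a * j'"
      using u by auto
    have "w x mod a = w x' mod a"
      using arg_cong[OF eq, of "\<lambda>z. z mod a"] by simp
    moreover from this have "x = x'"
      using bij x unfolding bij_betw_def inj_on_def by blast
    ultimately show "u = u'" using eq a uu by simp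
  qed
  then have "genus S = card ?D"
    unfolding genus_def using gaps_eq_apery[OF assms] by (simp only: card_image)
  also have "\<dots> = (\<Sum>x<a. w x div a)" by simp
  finally have "genus S = (\<Sum>x<a. w x div a)" .
  then have "a * genus S + (\<Sum>x<a. w x mod a) = (\<Sum>x<a. w x)"
    by (simp add: sum_distrib_left flip: sum.distrib)
  moreover have "(\<Sum>x<a. w x mod a) = \<Sum>{..<a}"
    using sum.reindex_bij_betw[OF bij, of "\<lambda>x. x"] .
  ultimately have "a * genus S + \<Sum>{..<a} = (\<Sum>x<a. w x)" by simp
  then have *: "real a * real (genus S) + real (\<Sum>{..<a}) = (\<Sum>x<a. real (w x))"
    by (metis of_nat_add of_nat_mult of_nat_sum)
  have gauss: "real (\<Sum>{..<m}) = real m * (real m - 1) / 2" for m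
    by (induction m) (auto simp: field_simps)
  show ?thesis
    using * a unfolding gauss by (simp add: field_simps)
qed

text \<open>The largest gap in a class that has gaps is \<open>w x - a\<close>, and monotonicity
  puts the maximum at \<open>x = a - 1\<close>.\<close>

lemma frobenius_number_apery:
  fixes a :: nat and w :: "nat \<Rightarrow> nat"
  assumes a: "a > 0"
    and bij: "bij_betw (\<lambda>x. w x mod a) {..<a} {..<a}"
    and up: "\<And>x j. x < a \<Longrightarrow> w x + a * j \<in> S"
    and low: "\<And>x y. x < a \<Longrightarrow> y \<in> S \<Longrightarrow> y mod a = w x mod a \<Longrightarrow> w x \<le> y"
    and mono: "\<And>x y. x \<le> y \<Longrightarrow> y < a \<Longrightarrow> w x \<le> w y"
  shows "frobenius_number S = int (w (a - 1)) - int a"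
proof -
  let ?m = "w (a - 1)"
  have gaps: "gaps S = (\<lambda>(x, j). w x mod a + a * j) ` (SIGMA x:{..<a}. {..<w x div a})"
    by (rule gaps_eq_apery[OF a bij up low])
  have le_m: "w x \<le> ?m" if "x < a" for x
    using mono[of x "a - 1"] that by linarith
  show ?thesis
  proof (cases "?m < a")
    \<comment> \<open>Every \<open>w x\<close> is below \<open>a\<close>, so there are no gaps. The
      residue \<open>a - 1\<close> is attained, which forces \<open>w (a - 1) = a - 1\<close>, and
      the formula yields the conventional value -1.\<close>
    case True
    have "gaps S = {}"
      unfolding gaps using le_m True by (fastforce dest: order.strict_trans1)
    moreover have "?m = a - 1"
    proof -
      have "a - 1 \<in> (\<lambda>x. w x mod a) ` {..<a}"
        using bij a by (simp add: bij_betw_def)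
      then obtain x where x: "x < a" "w x mod a = a - 1" by auto
      have "a - 1 \<le> w x" using x(2) by (metis mod_less_eq_dividend)
      with le_m[OF x(1)] True show ?thesis by linarith
    qed
    ultimately show ?thesis using a by (simp add: frobenius_number_def)
  next
    case False
    have mem: "?m - a \<in> gaps S"
    proof -
      have "?m - a \<notin> S"
      proof
        assume "?m - a \<in> S"
        moreover have "(?m - a) mod a = ?m mod a"
          using False by (simp add: le_mod_geq)
        ultimately have "?m \<le> ?m - a" using low[of "a - 1"] a by simp
        then show False using False a by linarith
      qed
      then show ?thesis by (simp add: gaps_def)
    qed
    have "y \<le> ?m - a" if "y \<in> gaps S" for y
    proof -
      have "\<exists>x j. x < a \<and> j < w x div a \<and> y = w x mod a + a * j"
        using that unfolding gaps by auto
      then obtain x j where x: "x < a" and j: "j < w x div a" and y: "y = w x mod a + a * j"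
        by blast
      have "y + a = w x mod a + a * Suc j" using y by simp
      also have "\<dots> \<le> w x mod a + a * (w x div a)"
        using j by (intro add_left_mono mult_le_mono2) simp
      also have "\<dots> \<le> ?m" using le_m[OF x] by simp
      finally show ?thesis by simp
    qed
    then have "Max (gaps S) = ?m - a"
      using mem by (intro Max_eqI) (auto simp: gaps)
    then show ?thesis
      using mem False by (auto simp: frobenius_number_def)
  qed
qed

section \<open>Greedy expansions in Fibonacci numbers of even index\<close>

text \<open>The reciprocal of the golden ratio; \<open>- psi\<close> is the negative root of t^2 = t
  + 1.\<close>

definition psi :: real where
  "psi = (sqrt 5 - 1) / 2"

lemma psi_square: "psi\<^sup>2 = 1 - psi"
  by (simp add: psi_def power2_eq_square field_simps)

lemma psi_pos: "psi > 0"
  by (simp add: psi_def)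

lemma psi_less_1: "psi < 1"
  using real_sqrt_less_mono[of 5 "3\<^sup>2"] by (simp add: psi_def)

lemma psi_ge_half: "psi \<ge> 1 / 2"
  using real_le_rsqrt[of 2 5] by (simp add: psi_def)

text \<open>Both sides satisfy the Fibonacci recurrence in \<open>m\<close>, since
  \<open>- psi\<close> is a root of t^2 = t + 1.\<close>

lemma fib_minus_psi_fib: "real (fib m) - psi * real (fib (Suc m)) = (- psi) ^ Suc m"
proof (induction m rule: fib.induct)
  case 2
  then show ?case using psi_square by (simp add: power2_eq_square)
next
  case (3 m)
  have "(- psi) ^ Suc (Suc (Suc m)) = (- psi) ^ Suc m * psi\<^sup>2"
    by (simp add: power2_eq_square)
  also have "\<dots> = (- psi) ^ Suc m + (- psi) ^ Suc (Suc m)"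
    unfolding psi_square by (simp add: algebra_simps)
  finally show ?case using 3 by (simp add: algebra_simps)
qed simp

lemma fib_minus_psi_fib_even:
  assumes "i \<ge> 1"
  shows "real (fib (2 * i - 1)) = psi * real (fib (2 * i)) + psi ^ (2 * i)"
  using fib_minus_psi_fib[of "2 * i - 1"] assms by (simp add: algebra_simps)

section \<open>Recursion and error of the greedy expansion\<close>

lemma greedy_coeff_top: "greedy_coeff k x k = x div fib (2 * k)"
  by (subst greedy_coeff.simps) simp

text \<open>Removing the leading term leaves the remainder modulo \<open>fib (2 * Suc k)\<close>, on
  which the algorithm continues from \<open>k\<close>. The induction runs downwards in
  \<open>j\<close>, because each coefficient depends on those above it.\<close>

lemma greedy_coeff_Suc:
  assumes "j \<le> k"
  shows "greedy_coeff (Suc k) x j = greedy_coeff k (x mod fib (2 * Suc k)) j"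
  using assms
proof (induction "k - j" arbitrary: j rule: less_induct)
  case less
  let ?F = "fib (2 * Suc k)"
  have "(\<Sum>i = Suc j..k. greedy_coeff (Suc k) x i * fib (2 * i))
      = (\<Sum>i = Suc j..k. greedy_coeff k (x mod ?F) i * fib (2 * i))"
    by (intro sum.cong refl arg_cong2[where f = "(*)"] less) auto
  then have "x - (\<Sum>i = Suc j..Suc k. greedy_coeff (Suc k) x i * fib (2 * i))
      = x - x div ?F * ?F - (\<Sum>i = Suc j..k. greedy_coeff k (x mod ?F) i * fib (2 * i))"
    using less.prems by (simp add: greedy_coeff_top del: fib.simps)
  also have "x - x div ?F * ?F = x mod ?F"
    by (simp only: minus_div_mult_eq_mod)
  finally show ?case
    by (subst (1 2) greedy_coeff.simps) (simp only:)
qed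

text \<open>The weights are arbitrary so that one recursion serves both the expansion of
  \<open>x\<close> (weights \<open>fib (2 * i)\<close>) and the error (weights
  \<open>psi ^ (2 * i)\<close>).\<close>

lemma sum_greedy_coeff_Suc:
  fixes g :: "nat \<Rightarrow> 'a :: semiring_1"
  shows "(\<Sum>i = 1..Suc k. of_nat (greedy_coeff (Suc k) x i) * g i)
    = of_nat (x div fib (2 * Suc k)) * g (Suc k)
      + (\<Sum>i = 1..k. of_nat (greedy_coeff k (x mod fib (2 * Suc k)) i) * g i)"
proof -
  have "(\<Sum>i = 1..k. of_nat (greedy_coeff (Suc k) x i) * g i)
      = (\<Sum>i = 1..k. of_nat (greedy_coeff k (x mod fib (2 * Suc k)) i) * g i)"
    by (intro sum.cong refl) (simp add: greedy_coeff_Suc del: fib.simps mult_Suc_right)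
  then show ?thesis
    by (simp add: greedy_coeff_top add.commute del: fib.simps mult_Suc_right)
qed

lemma greedy_coeff_expansion:
  assumes "x < fib (2 * k + 2)"
  shows "(\<Sum>i = 1..k. greedy_coeff k x i * fib (2 * i)) = x"
  using assms
proof (induction k arbitrary: x)
  case 0
  then show ?case by (simp add: numeral_2_eq_2)
next
  case (Suc k)
  have "fib (2 * Suc k) > 0" by (simp add: fib_neq_0_nat)
  then have "x mod fib (2 * Suc k) < fib (2 * k + 2)" by simp
  from Suc.IH[OF this] show ?case
    using sum_greedy_coeff_Suc[of k x "\<lambda>i. fib (2 * i)"]
    by (simp del: fib.simps mult_Suc_right sum.cl_ivl_Suc)
qed

text \<open>
  The bound for \<open>x < fib (2 * k + 1)\<close> is needed because, after a leading coefficient 2, the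
  remainder lies below a Fibonacci number of odd index.
\<close>

lemma greedy_error:
  defines "err \<equiv> \<lambda>k x. \<Sum>i = 1..k. real (greedy_coeff k x i) * psi ^ (2 * i)"
  shows "(x < fib (2 * k + 2) \<longrightarrow> err k x \<le> 1 - psi ^ (2 * k + 1))
    \<and> (x < fib (2 * k + 1) \<longrightarrow> err k x \<le> 1 - psi ^ (2 * k))"
proof (induction k arbitrary: x)
  case 0
  then show ?case using psi_less_1 by (simp add: err_def)
next
  case (Suc k)
  define p where "p = psi ^ (2 * k)"
  define F where "F = fib (2 * k + 2)"
  define G where "G = fib (2 * k + 1)"
  have p: "p \<ge> 0" using psi_pos by (simp add: p_def)
  \<comment> \<open>Reducing by psi^2 = 1 - psi makes every bound linear in \<open>p\<close> and
    \<open>p * psi\<close>.\<close>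
  have pows: "psi ^ (2 * k + 1) = p * psi" "psi ^ (2 * Suc k) = p * (1 - psi)"
    "psi ^ (2 * Suc k + 1) = p * (2 * psi - 1)"
  proof -
    show "psi ^ (2 * k + 1) = p * psi" by (simp add: p_def)
    show 2: "psi ^ (2 * Suc k) = p * (1 - psi)"
      by (simp add: p_def psi_square[symmetric] power2_eq_square)
    have "psi ^ (2 * Suc k + 1) = psi ^ (2 * Suc k) * psi" by simp
    also have "\<dots> = p * (psi - psi\<^sup>2)"
      unfolding 2 by (simp add: power2_eq_square algebra_simps)
    finally show "psi ^ (2 * Suc k + 1) = p * (2 * psi - 1)"
      by (simp add: psi_square)
  qed
  have pp: "p * psi \<le> p" "p * psi \<ge> 0"
    using p psi_less_1 psi_pos by (simp_all add: mult_left_le)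
  have half: "p \<le> 2 * (p * psi)"
    using mult_left_mono[OF psi_ge_half p] by simp
  have fibs: "fib (2 * Suc k) = F" "fib (2 * Suc k + 1) = F + G" "fib (2 * Suc k + 2) = 2 * F + G"
    by (simp_all add: F_def G_def)
  have "F > 0" by (simp add: F_def fib_neq_0_nat)
  have "G \<le> F" by (simp add: F_def G_def)
  have step: "err (Suc k) x = real (x div F) * (p * (1 - psi)) + err k (x mod F)"
    using sum_greedy_coeff_Suc[of k x "\<lambda>i. psi ^ (2 * i)"]
    unfolding err_def fibs pows by simp
  have P: "err k (x mod F) \<le> 1 - p * psi"
    using Suc.IH[of "x mod F"] \<open>F > 0\<close> unfolding pows F_def[symmetric] by simp
  have Q: "err k (x mod F) \<le> 1 - p" if "x mod F < G"
    using Suc.IH[of "x mod F"] that unfolding G_def[symmetric] p_def[symmetric] by simp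
  have split: "x = F * (x div F) + x mod F" by simp
  show ?case
    unfolding fibs pows
  proof (intro conjI impI)
    assume x: "x < 2 * F + G"
    \<comment> \<open>From \<open>G \<le> F\<close> follows 2F + G \<le> 3F, so the leading
      coefficient is at most 2.\<close>
    have "x div F < 3"
      using x \<open>G \<le> F\<close> \<open>F > 0\<close> by (simp add: less_mult_imp_div_less)
    then consider "x div F = 0" | "x div F = 1" | "x div F = 2" by linarith
    then show "err (Suc k) x \<le> 1 - p * (2 * psi - 1)"
    proof cases
      case 3
      then have "x mod F < G" using split x by simp
      \<comment> \<open>The bounds match exactly: 2(1 - psi) - 1 = -(2 psi - 1). The weaker bound
        \<open>P\<close> would not suffice here.\<close>
      from Q[OF this] show ?thesis unfolding step 3 by (simp add: algebra_simps)
    qed (use P pp in \<open>simp_all add: step algebra_simps\<close>)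
  next
    assume x: "x < F + G"
    have "x div F < 2"
      using x \<open>G \<le> F\<close> \<open>F > 0\<close> by (simp add: less_mult_imp_div_less)
    then consider "x div F = 0" | "x div F = 1" by linarith
    then show "err (Suc k) x \<le> 1 - p * (1 - psi)"
    proof cases
      case 1
      then show ?thesis using P half by (simp add: step algebra_simps)
    next
      case 2
      then have "x mod F < G" using split x by simp
      from Q[OF this] show ?thesis using half unfolding step 2 by (simp add: algebra_simps)
    qed
  qed
qed

section \<open>The starting index and the coefficient of \<open>V n\<close>\<close>

lemma less_fib_even: "x < fib (2 * x + 2)"
proof (induction x)
  case (Suc x)
  have "fib (2 * x + 3) > 0" by (simp add: fib_neq_0_nat)
  with Suc show ?case by (simp add: numeral_3_eq_3)
qed simp

text \<open>The intervals from \<open>fib (2 * k)\<close> to \<open>fib (2 * k + 2)\<close> with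
  \<open>k \<ge> 1\<close> are disjoint and cover the positive integers. The definite description in
  \<open>fib_index\<close> is therefore the least \<open>k\<close> with
  \<open>x < fib (2 * k + 2)\<close>.\<close>

lemma fib_index_bound:
  assumes "x > 0"
  shows "x < fib (2 * fib_index x + 2)"
proof -
  define k where "k = (LEAST k. x < fib (2 * k + 2))"
  have k: "x < fib (2 * k + 2)"
    unfolding k_def by (rule LeastI[of _ x]) (rule less_fib_even)
  have "k \<noteq> 0" using k assms by (cases k) auto
  then have "k \<ge> 1" by simp
  have "fib (2 * k) \<le> x"
    using \<open>k \<noteq> 0\<close> not_less_Least[of "k - 1" "\<lambda>k. x < fib (2 * k + 2)"]
    unfolding k_def[symmetric] by (cases k) (auto simp del: fib.simps)
  moreover have "l = k" if "fib (2 * l) \<le> x" "x < fib (2 * l + 2)" for l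
  proof (rule ccontr)
    assume "l \<noteq> k"
    then have "2 * l + 2 \<le> 2 * k \<or> 2 * k + 2 \<le> 2 * l" by linarith
    with that k \<open>fib (2 * k) \<le> x\<close> show False
      using fib_mono[of "2 * l + 2" "2 * k"] fib_mono[of "2 * k + 2" "2 * l"] by linarith
  qed
  ultimately have "fib_index x = k"
    unfolding fib_index_def using k \<open>k \<ge> 1\<close> by blast
  then show ?thesis using k by simp
qed

text \<open>The coefficient of \<open>V n\<close> in \<open>s_value V n x\<close>.\<close>

definition greedy_odd :: "nat \<Rightarrow> nat" where
  "greedy_odd x = (\<Sum>i = 1..fib_index x. greedy_coeff (fib_index x) x i * fib (2 * i - 1))"

text \<open>Settles \<open>x = 0\<close> for every \<open>k\<close>, in particular for the
  unspecified \<open>fib_index 0\<close>.\<close>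

lemma greedy_coeff_0: "greedy_coeff k 0 j = 0"
  by (subst greedy_coeff.simps) simp

lemma fib_index_expansion:
  "(\<Sum>i = 1..fib_index x. greedy_coeff (fib_index x) x i * fib (2 * i)) = x"
proof (cases "x = 0")
  case False
  then show ?thesis by (intro greedy_coeff_expansion fib_index_bound) simp
qed (simp add: greedy_coeff_0)

text \<open>By \<open>fib_minus_psi_fib_even\<close>, \<open>greedy_odd x\<close> exceeds
  \<open>psi * x\<close> by exactly the error sum, which lies in [0, 1). Hence
  \<open>greedy_odd x\<close> is the ceiling of \<open>psi * x\<close>.\<close>

lemma greedy_odd_bounds: "psi * real x \<le> real (greedy_odd x)" "real (greedy_odd x) < psi * real x + 1"
proof -
  let ?k = "fib_index x"
  let ?err = "\<Sum>i = 1..?k. real (greedy_coeff ?k x i) * psi ^ (2 * i)"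
  have "real (greedy_odd x)
      = (\<Sum>i = 1..?k. psi * (real (greedy_coeff ?k x i) * real (fib (2 * i)))
          + real (greedy_coeff ?k x i) * psi ^ (2 * i))"
    unfolding greedy_odd_def of_nat_sum
    by (intro sum.cong refl) (simp add: fib_minus_psi_fib_even distrib_left mult.left_commute del: One_nat_def)
  also have "\<dots> = psi * real (\<Sum>i = 1..?k. greedy_coeff ?k x i * fib (2 * i)) + ?err"
    by (simp add: sum.distrib sum_distrib_left)
  finally have eq: "real (greedy_odd x) = psi * real x + ?err"
    unfolding fib_index_expansion .
  have "?err \<ge> 0" using psi_pos by (intro sum_nonneg) simp
  then show "psi * real x \<le> real (greedy_odd x)" using eq by simp
  have "?err < 1"
  proof (cases "x = 0")
    case False
    then have "?err \<le> 1 - psi ^ (2 * ?k + 1)"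
      using greedy_error fib_index_bound by blast
    also have "\<dots> < 1" using psi_pos by simp
    finally show ?thesis .
  qed (simp add: greedy_coeff_0)
  then show "real (greedy_odd x) < psi * real x + 1" using eq by simp
qed

text \<open>Serves both minimality of \<open>s_value\<close> and, with
  \<open>c = greedy_odd y\<close>, its monotonicity.\<close>

lemma greedy_odd_le:
  assumes "psi * real y \<le> real c" "x \<le> y"
  shows "greedy_odd x \<le> c"
proof -
  have "psi * real x \<le> psi * real y" using assms psi_pos by simp
  then have "real (greedy_odd x) < real c + 1"
    using assms(1) greedy_odd_bounds(2)[of x] by linarith
  then show ?thesis by linarith
qed

section \<open>Semigroups generated by alternate terms of a Fibonacci-like sequence\<close>

lemma nonneg_combinations_0: "0 \<in> nonneg_combinations A"
  unfolding nonneg_combinations_def by (auto intro!: exI[of _ "{}"])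

lemma nonneg_combinations_add:
  assumes y: "y \<in> nonneg_combinations A" and v: "v \<in> A"
  shows "y + k * v \<in> nonneg_combinations A"
proof -
  obtain T c where T: "y = (\<Sum>a\<in>T. c a * a)" "finite T" "T \<subseteq> A"
    using y unfolding nonneg_combinations_def by blast
  \<comment> \<open>The values of \<open>c\<close> outside \<open>T\<close> are arbitrary and
    \<open>v\<close> may already lie in \<open>T\<close>; cutting \<open>c\<close> off to 0 treats
    both cases at once.\<close>
  define d where "d a = (if a \<in> T then c a else 0)" for a
  have "(\<Sum>a\<in>insert v T. (d a + (if a = v then k else 0)) * a)
      = (\<Sum>a\<in>insert v T. d a * a) + (\<Sum>a\<in>insert v T. if a = v then k * v else 0)"
    unfolding sum.distrib[symmetric] by (intro sum.cong) (auto simp: algebra_simps)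
  also have "(\<Sum>a\<in>insert v T. d a * a) = (\<Sum>a\<in>T. d a * a)"
    using T(2) by (intro sum.mono_neutral_right) (auto simp: d_def)
  also have "\<dots> = y" unfolding T(1) by (intro sum.cong) (auto simp: d_def)
  also have "(\<Sum>a\<in>insert v T. if a = v then k * v else 0) = k * v"
    using T(2) by simp
  finally show ?thesis
    using T v unfolding nonneg_combinations_def
    by (auto intro!: exI[of _ "insert v T"] exI[of _ "\<lambda>a. d a + (if a = v then k else 0)"])
qed

lemma nonneg_combinations_add_sum:
  assumes "y \<in> nonneg_combinations A" "finite I" "\<And>i. i \<in> I \<Longrightarrow> v i \<in> A"
  shows "y + (\<Sum>i\<in>I. k i * v i) \<in> nonneg_combinations A"
  using assms(2,3)
proof (induction I)
  case (insert i I)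
  then show ?case
    using nonneg_combinations_add[of "y + (\<Sum>i\<in>I. k i * v i)" A "v i" "k i"]
    by (simp add: add_ac)
qed (use assms in simp)

section \<open>The sequence and the Apery set of its semigroup\<close>

locale fib_like =
  fixes V :: "nat \<Rightarrow> nat" and n :: nat
  assumes V1: "V 1 > 0" and V2: "V 2 > 0"
    and cop: "gcd (V 1) (V 2) = 1"
    and rec: "\<forall>m\<ge>3. V m = V (m - 1) + V (m - 2)"
    and n: "n > 0"
begin

lemma V_step: "m > 0 \<Longrightarrow> V (Suc (Suc m)) = V (Suc m) + V m"
  using rec[rule_format, of "Suc (Suc m)"] by simp

text \<open>A Euclidean step preserves the gcd of consecutive terms. The indices start at 1 because
  the recurrence does not constrain \<open>V 0\<close>.\<close>

lemma V_pos_coprime: "V (Suc m) > 0 \<and> V (Suc (Suc m)) > 0 \<and> coprime (V (Suc m)) (V (Suc (Suc m)))"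
proof (induction m)
  case 0
  then show ?case using V1 V2 cop by (simp add: coprime_iff_gcd_eq_1 numeral_2_eq_2)
next
  case (Suc m)
  then show ?case using V_step[of "Suc m"] by (simp add: coprime_iff_gcd_eq_1 gcd.commute)
qed

lemma V_pos: "V n > 0"
  using V_pos_coprime[of "n - 1"] n by simp

lemma V_coprime: "coprime (V n) (V (Suc n))"
  using V_pos_coprime[of "n - 1"] n by simp

lemma V_fib: "V (n + Suc m) = fib m * V n + fib (Suc m) * V (Suc n)"
proof (induction m rule: fib.induct)
  case 2
  then show ?case using V_step[of n] n by simp
next
  case (3 m)
  then show ?case using V_step[of "n + Suc m"] n by (simp add: algebra_simps)
qed simp

lemma V_even:
  assumes "i \<ge> 1"
  shows "V (n + 2 * i) = fib (2 * i - 1) * V n + fib (2 * i) * V (Suc n)"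
  using V_fib[of "2 * i - 1"] assms by simp

text \<open>Splitting each generator by \<open>V_even\<close>, the multiples of
  \<open>V (Suc n)\<close> collect to the greedy expansion of \<open>x\<close> itself.\<close>

lemma s_value_eq: "s_value V n x = V n * greedy_odd x + V (Suc n) * x"
proof -
  let ?k = "fib_index x"
  have "s_value V n x = (\<Sum>i = 1..?k. V n * (greedy_coeff ?k x i * fib (2 * i - 1))
      + V (Suc n) * (greedy_coeff ?k x i * fib (2 * i)))"
    unfolding s_value_def by (intro sum.cong refl) (subst V_even, auto simp: algebra_simps)
  also have "\<dots> = V n * greedy_odd x
      + V (Suc n) * (\<Sum>i = 1..?k. greedy_coeff ?k x i * fib (2 * i))"
    by (simp add: sum.distrib sum_distrib_left greedy_odd_def)
  finally show ?thesis unfolding fib_index_expansion .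
qed

abbreviation (input) semigroup where
  "semigroup \<equiv> nonneg_combinations {V (n + 2 * i) | i. True}"

lemma s_value_add_mem: "s_value V n x + V n * j \<in> semigroup"
proof -
  \<comment> \<open>The generator with \<open>i = 0\<close> is \<open>V n\<close>, which supplies
    the multiple \<open>V n * j\<close>.\<close>
  have "V (n + 2 * 0) \<in> {V (n + 2 * i) | i. True}" by blast
  then have "0 + j * V n \<in> semigroup"
    by (intro nonneg_combinations_add nonneg_combinations_0) simp
  then have "0 + j * V n + s_value V n x \<in> semigroup"
    unfolding s_value_def by (rule nonneg_combinations_add_sum) auto
  then show ?thesis by (simp add: ac_simps)
qed

text \<open>The inequality is preserved by non-negative combinations, so it is enough to check it on
  generators, where the slack is \<open>psi ^ (2 * i)\<close>.\<close>

lemma semigroup_representation: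
  assumes "y \<in> semigroup"
  shows "\<exists>c X. y = V n * c + V (Suc n) * X \<and> psi * real X \<le> real c"
proof -
  obtain T d where T: "y = (\<Sum>a\<in>T. d a * a)" "finite T" "T \<subseteq> {V (n + 2 * i) | i. True}"
    using assms unfolding nonneg_combinations_def by blast
  show ?thesis
    using T(2,3) unfolding T(1)
  proof (induction T)
    case (insert v T)
    then obtain c X where cX: "(\<Sum>a\<in>T. d a * a) = V n * c + V (Suc n) * X"
      "psi * real X \<le> real c" by auto
    obtain i where i: "v = V (n + 2 * i)" using insert.prems by auto
    obtain c' X' where v: "v = V n * c' + V (Suc n) * X'" "psi * real X' \<le> real c'"
    \<comment> \<open>For \<open>i = 0\<close> the pair is (1, 0). The general formula fails there,
      since \<open>2 * i - 1\<close> truncates to 0 and \<open>fib 0 = 0\<close>.\<close>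
    proof (cases "i = 0")
      case True
      then show ?thesis using that[of 1 0] i by simp
    next
      case False
      then show ?thesis
        using that[of "fib (2 * i - 1)" "fib (2 * i)"] i V_even[of i] psi_pos
          fib_minus_psi_fib_even[of i] by (simp add: mult.commute)
    qed
    have "(\<Sum>a\<in>insert v T. d a * a) = V n * (d v * c' + c) + V (Suc n) * (d v * X' + X)"
    proof -
      have "(\<Sum>a\<in>insert v T. d a * a) = d v * v + (V n * c + V (Suc n) * X)"
        using insert.hyps cX(1) by simp
      also have "d v * v = d v * (V n * c' + V (Suc n) * X')" using v(1) by simp
      finally show ?thesis by (simp add: algebra_simps)
    qed
    moreover have "psi * real (d v * X' + X) \<le> real (d v * c' + c)"
      using cX(2) mult_left_mono[OF v(2), of "real (d v)"] by (simp add: algebra_simps)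
    ultimately show ?case by blast
  qed (auto intro!: exI[of _ 0])
qed

text \<open>Cancelling the unit \<open>V (Suc n)\<close> modulo \<open>V n\<close> gives X = x
  modulo \<open>V n\<close>, hence \<open>x \<le> X\<close> as \<open>x < V n\<close>. Then both
  coefficients of \<open>y\<close> dominate those of \<open>s_value V n x\<close>.\<close>

lemma s_value_least:
  assumes x: "x < V n" and y: "y \<in> semigroup" and cong: "y mod V n = s_value V n x mod V n"
  shows "s_value V n x \<le> y"
proof -
  obtain c X where cX: "y = V n * c + V (Suc n) * X" "psi * real X \<le> real c"
    using semigroup_representation[OF y] by blast
  have "[V (Suc n) * X = V (Suc n) * x] (mod V n)"
    using cong unfolding cX(1) s_value_eq by (simp add: cong_def)
  then have "[X = x] (mod V n)"
    using V_coprime by (simp add: cong_mult_lcancel_nat coprime_commute)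
  then have "x \<le> X" using x by (metis cong_def mod_less mod_less_eq_dividend)
  with greedy_odd_le[OF cX(2) this] show ?thesis
    unfolding cX(1) s_value_eq by (intro add_mono mult_le_mono2)
qed

lemma s_value_mono: "x \<le> y \<Longrightarrow> s_value V n x \<le> s_value V n y"
  unfolding s_value_eq by (intro add_mono mult_le_mono2 greedy_odd_le[OF greedy_odd_bounds(1)])

text \<open>Modulo \<open>V n\<close> the map is multiplication by the unit
  \<open>V (Suc n)\<close>; an injective self-map of a finite set is bijective.\<close>

lemma s_value_bij: "bij_betw (\<lambda>x. s_value V n x mod V n) {..<V n} {..<V n}"
proof -
  have "inj_on (\<lambda>x. s_value V n x mod V n) {..<V n}"
  proof (rule inj_onI)
    fix x y assume xy: "x \<in> {..<V n}" "y \<in> {..<V n}"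
      and "s_value V n x mod V n = s_value V n y mod V n"
    then have "[V (Suc n) * x = V (Suc n) * y] (mod V n)"
      unfolding s_value_eq by (simp add: cong_def)
    then have "[x = y] (mod V n)"
      using V_coprime by (simp add: cong_mult_lcancel_nat coprime_commute)
    then show "x = y" using xy by (simp add: cong_def)
  qed
  moreover have "(\<lambda>x. s_value V n x mod V n) ` {..<V n} \<subseteq> {..<V n}"
    using V_pos by auto
  ultimately show ?thesis
    by (simp add: bij_betw_def endo_inj_surj)
qed

end

theorem theorem4p7:
  fixes V :: "nat \<Rightarrow> nat" and n :: nat and S :: "nat set"
  assumes "V 1 > 0" and "V 2 > 0"
    and "gcd (V 1) (V 2) = 1"
    and "\<forall>m\<ge>3. V m = V (m - 1) + V (m - 2)"
    and "n > 0"
    and "S = nonneg_combinations {V (n + 2 * i) | i. True}"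
  shows "finite (gaps S)
    \<and> frobenius_number S = int (s_value V n (V n - 1)) - int (V n)
    \<and> real (genus S) =
        1 / real (V n) * (\<Sum>x = 1..V n - 1. real (s_value V n x)) - (real (V n) - 1) / 2"
proof -
  interpret fib_like V n using assms(1-5) by unfold_locales
  have up: "s_value V n x + V n * j \<in> S" for x j
    unfolding assms(6) by (rule s_value_add_mem)
  have low: "s_value V n x \<le> y"
    if "x < V n" "y \<in> S" "y mod V n = s_value V n x mod V n" for x y
    using that unfolding assms(6) by (rule s_value_least)
  note apery = V_pos s_value_bij up low
  have "finite (gaps S)"
    by (subst gaps_eq_apery[OF apery]) auto
  moreover have "frobenius_number S = int (s_value V n (V n - 1)) - int (V n)"
    by (rule frobenius_number_apery[OF apery s_value_mono])
  moreover have "(\<Sum>x<V n. real (s_value V n x)) = (\<Sum>x = 1..V n - 1. real (s_value V n x))"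
  proof (rule sum.mono_neutral_right)
    \<comment> \<open>The Apery sum starts at \<open>x = 0\<close> and the stated sum at 1; the
      extra term vanishes.\<close>
    have "s_value V n 0 = 0" by (simp add: s_value_def greedy_coeff_0)
    then show "\<forall>x\<in>{..<V n} - {1..V n - 1}. real (s_value V n x) = 0"
      by (auto simp: not_le)
  qed (use V_pos in auto)
  ultimately show ?thesis
    using genus_apery[OF apery] by (simp only: simp_thms)
qed

end
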